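(* For $n\ge 0$, $$\left|\mathcal{S}^2_n(231)\right|=\sum_{i=0}^{n}\frac{1}{5n+i+1}\binom{5n+1}{n-i}\binom{5n+2i}{i}.$$
   Context: $\mathcal{S}^2_n(P)$ denotes the set of permutations $\pi\in\mathcal{S}_{3n}$ that avoid every pattern in $P$ (classical pattern avoidance) and satisfy $\pi_{3i+1}<\pi_{3i+2}$ and $\pi_{3i+1}<\pi_{3i+3}$ for all $0\le i<n$. *)

theory Defs
  imports
    Complex_Main
    "HOL-Library.Sublist"
    "HOL-Combinatorics.Multiset_Permutations"
begin

definition order_isomorphic :: "nat list \<Rightarrow> nat list \<Rightarrow> bool" where
  "order_isomorphic xs ys \<longleftrightarrow>
     length xs = length ys \<and>
     (\<forall>i < length xs. \<forall>j < length xs. xs ! i < xs ! j \<longleftrightarrow> ys ! i < ys ! j)"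

definition contains_pattern :: "nat list \<Rightarrow> nat list \<Rightarrow> bool" where
  "contains_pattern xs p \<longleftrightarrow> (\<exists>ys. subseq ys xs \<and> order_isomorphic ys p)"

definition avoids_pattern :: "nat list \<Rightarrow> nat list \<Rightarrow> bool" where
  "avoids_pattern xs p \<longleftrightarrow> \<not> contains_pattern xs p"

text \<open>
  Permutations are in one-line notation: the list entry at position \<open>k - 1\<close> is the
  value \<open>\<pi>\<^sub>k\<close>. Hence \<open>\<pi>\<close> at \<open>3i + 1\<close>, \<open>3i + 2\<close>, \<open>3i + 3\<close> is found at
  the list positions \<open>3i\<close>, \<open>3i + 1\<close>, \<open>3i + 2\<close>.
\<close>

definition S2 :: "nat \<Rightarrow> nat list set \<Rightarrow> nat list set" where
  "S2 n P = {\<pi> \<in> permutations_of_set {1..3 * n}.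
     (\<forall>p \<in> P. avoids_pattern \<pi> p) \<and>
     (\<forall>i < n. \<pi> ! (3 * i) < \<pi> ! (3 * i + 1) \<and> \<pi> ! (3 * i) < \<pi> ! (3 * i + 2))}"

end

theory Submission
  imports Defs "HOL-Computational_Algebra.Formal_Power_Series"
begin

text \<open>
  A word avoiding 231 is \<open>a s b\<close> with all letters of \<open>s\<close> below and all letters of \<open>b\<close> above the
  first letter \<open>a\<close>, where \<open>s\<close> and \<open>b\<close> avoid 231. A triple reaching from \<open>s\<close> into \<open>b\<close> satisfies
  its inequalities automatically, and a letter \<open>a\<close> that opens a triple forces \<open>s\<close> to be empty.
  Refining by the residues modulo 3 of the starting and stopping positions gives nine equations
  for generating functions \<open>F\<^sub>k\<^sub>e\<close> in \<open>z\<close> (marking the length), which have exactly one solution.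
  With \<open>v = z\<^sup>3 g\<^sup>5\<close>, \<open>g = (1 + v) C(v)\<close> and \<open>C = 1 + v C\<^sup>2\<close> the Catalan series, the solution consists of
  monomials in \<open>z\<close>, \<open>g\<close>, \<open>C(v)\<close>, \<open>1 + C(v)\<close>, with \<open>F\<^sub>0\<^sub>0 = g\<close>. Lagrange inversion then yields
  \<open>[z\<^sup>3\<^sup>n] g = [v\<^sup>n] ((1 + v) C(v))\<^sup>5\<^sup>n\<^sup>+\<^sup>1 / (5n + 1)\<close>, and a second Lagrange inversion gives the
  coefficients of the powers of \<open>C\<close>.
\<close>

unbundle fps_syntax

subsection \<open>Decomposition at the first letter\<close>

text \<open>Only the letter in the role of 2 is peeled off, so that the recursion follows the
  decomposition at the first letter.\<close>

fun avoids231 :: "nat list \<Rightarrow> bool" where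
  "avoids231 [] \<longleftrightarrow> True"
| "avoids231 (x # xs) \<longleftrightarrow>
     avoids231 xs \<and> (\<forall>p q. subseq [p, q] xs \<longrightarrow> \<not> (q < x \<and> x < p))"

lemma subseq_pairD: "subseq [p, q] xs \<Longrightarrow> p \<in> set xs \<and> q \<in> set xs"
  by (induction xs) (auto simp: subseq_singleton_left split: if_splits)

lemma subseq_pair_append:
  "subseq [p, q] (xs @ ys) \<longleftrightarrow> subseq [p, q] xs \<or> (p \<in> set xs \<and> q \<in> set ys) \<or> subseq [p, q] ys"
  by (induction xs) (auto simp: subseq_singleton_left dest: subseq_pairD)

lemma order_isomorphic_231:
  "order_isomorphic ys [2, 3, 1] \<longleftrightarrow> (\<exists>x p q. ys = [x, p, q] \<and> q < x \<and> x < p)"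
proof
  assume iso: "order_isomorphic ys [2, 3, 1]"
  then obtain x p q where "ys = [x, p, q]"
    by (auto simp: order_isomorphic_def numeral_eq_Suc length_Suc_conv)
  moreover have "[x, p, q] ! i < [x, p, q] ! j \<longleftrightarrow> [2, 3, 1 :: nat] ! i < [2, 3, 1] ! j"
    if "i < 3" "j < 3" for i j
    using iso that by (simp add: order_isomorphic_def \<open>ys = [x, p, q]\<close>)
  from this[of 2 0] this[of 0 1] have "q < x" "x < p" by simp_all
  ultimately show "\<exists>x p q. ys = [x, p, q] \<and> q < x \<and> x < p" by blast
next
  assume "\<exists>x p q. ys = [x, p, q] \<and> q < x \<and> x < p"
  then show "order_isomorphic ys [2, 3, 1]"
    by (auto simp: order_isomorphic_def less_Suc_eq)
qed

lemma avoids231_iff_subseq: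
  "avoids231 xs \<longleftrightarrow> (\<forall>x p q. subseq [x, p, q] xs \<longrightarrow> \<not> (q < x \<and> x < p))"
proof (induction xs)
  case (Cons a xs)
  have "subseq [x, p, q] (a # xs) \<longleftrightarrow> subseq [x, p, q] xs \<or> x = a \<and> subseq [p, q] xs" for x p q
    by (auto dest: subseq_Cons')
  then show ?case unfolding avoids231.simps Cons.IH by blast
qed simp

lemma avoids231_iff: "avoids231 xs \<longleftrightarrow> avoids_pattern xs [2, 3, 1]"
  unfolding avoids231_iff_subseq avoids_pattern_def contains_pattern_def order_isomorphic_231
  by blast

text \<open>The last letter of an occurrence is its smallest. An occurrence that starts in
  \<open>xs\<close> therefore cannot end in \<open>ys\<close>, and none straddles the two
  words.\<close>

lemma avoids231_append:
  assumes "\<forall>x\<in>set xs. \<forall>y\<in>set ys. x < y"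
  shows "avoids231 (xs @ ys) \<longleftrightarrow> avoids231 xs \<and> avoids231 ys"
  using assms
proof (induction xs)
  case (Cons x xs)
  have "\<not> q < x" if "q \<in> set ys" for q
    using Cons.prems that by (auto dest: less_asym)
  then have "subseq [p, q] (xs @ ys) \<and> q < x \<and> x < p \<longleftrightarrow> subseq [p, q] xs \<and> q < x \<and> x < p" for p q
    unfolding subseq_pair_append using subseq_pairD[of p q ys] by blast
  moreover have "avoids231 (xs @ ys) \<longleftrightarrow> avoids231 xs \<and> avoids231 ys"
    using Cons by simp
  ultimately show ?case unfolding append_Cons avoids231.simps by blast
qed simp

text \<open>Here \<open>k\<close> is the position of the first letter. \<open>take 2\<close> stops
  at the end of the word, so a triple that is cut off there is tested only as far as it goes, and a
  piece may start and stop anywhere inside a triple.\<close>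

fun phased :: "nat \<Rightarrow> nat list \<Rightarrow> bool" where
  "phased k [] \<longleftrightarrow> True"
| "phased k (x # xs) \<longleftrightarrow> (3 dvd k \<longrightarrow> (\<forall>y\<in>set (take 2 xs). x < y)) \<and> phased (Suc k) xs"

text \<open>An inequality that compares a letter of \<open>xs\<close> with one of \<open>ys\<close>
  holds by assumption, so only those inside one of the two words remain.\<close>

lemma phased_append:
  assumes "\<forall>x\<in>set xs. \<forall>y\<in>set ys. x < y"
  shows "phased k (xs @ ys) \<longleftrightarrow> phased k xs \<and> phased (k + length xs) ys"
  using assms
  by (induction xs arbitrary: k) (auto dest: in_set_takeD)

lemma phased_add_3: "phased (k + 3) xs \<longleftrightarrow> phased k xs"
proof (induction xs arbitrary: k)
  case (Cons x xs)
  have "3 dvd k + 3 \<longleftrightarrow> 3 dvd k" by presburger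
  then show ?case using Cons[of "Suc k"] by simp
qed simp

lemma phased_mod_3: "phased (k mod 3) xs \<longleftrightarrow> phased k xs"
proof -
  have "phased (k mod 3 + 3 * j) xs \<longleftrightarrow> phased (k mod 3) xs" for j
  proof (induction j)
    case (Suc j)
    then show ?case using phased_add_3[of "k mod 3 + 3 * j" xs] by (simp add: add_ac)
  qed simp
  from this[of "k div 3"] show ?thesis by simp
qed

lemma phased_0_iff:
  assumes "length xs = 3 * n"
  shows "phased 0 xs \<longleftrightarrow>
    (\<forall>i<n. xs ! (3 * i) < xs ! (3 * i + 1) \<and> xs ! (3 * i) < xs ! (3 * i + 2))"
  using assms
proof (induction n arbitrary: xs)
  case (Suc n)
  then obtain x y z zs where xs: "xs = x # y # z # zs" and len: "length zs = 3 * n"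
    by (auto simp: length_Suc_conv numeral_eq_Suc)
  have "phased 0 xs \<longleftrightarrow> x < y \<and> x < z \<and> phased 0 zs"
  proof -
    have "\<not> 3 dvd Suc 0" "\<not> 3 dvd Suc (Suc 0)" by presburger+
    moreover have "phased (Suc (Suc (Suc 0))) zs \<longleftrightarrow> phased 0 zs"
      using phased_add_3[of 0 zs] by (simp add: numeral_3_eq_3)
    ultimately show ?thesis by (auto simp: xs)
  qed
  also have "\<dots> \<longleftrightarrow> (\<forall>i<Suc n. xs ! (3 * i) < xs ! (3 * i + 1) \<and> xs ! (3 * i) < xs ! (3 * i + 2))"
    unfolding Suc.IH[OF len] All_less_Suc2 by (simp add: xs numeral_eq_Suc)
  finally show ?case .
qed simp

text \<open>The offset \<open>c\<close> allows the two pieces of a word, whose letters again form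
  intervals, to be words of the same kind without relabelling.\<close>

definition phased_words :: "nat \<Rightarrow> nat \<Rightarrow> nat \<Rightarrow> nat list set" where
  "phased_words k m c =
     {xs. distinct xs \<and> set xs = {c..<c + m} \<and> avoids231 xs \<and> phased k xs}"

lemma length_phased_words: "xs \<in> phased_words k m c \<Longrightarrow> length xs = m"
  by (auto simp: phased_words_def dest: distinct_card)

lemma finite_phased_words: "finite (phased_words k m c)"
  by (rule finite_subset[OF _ finite_lists_length_eq[of "{c..<c + m}" m]])
    (auto simp: phased_words_def dest: distinct_card)

lemma phased_words_mod_3: "phased_words (k mod 3) m c = phased_words k m c"
  by (simp add: phased_words_def phased_mod_3)

lemma phased_words_0: "phased_words k 0 c = {[]}"
  by (auto simp: phased_words_def)

text \<open>After the first letter \<open>p\<close> above \<open>x\<close>, any letter below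
  \<open>x\<close> would complete a 231 with \<open>x\<close> and \<open>p\<close>.\<close>

lemma avoids231_Cons_split:
  assumes "avoids231 (x # xs)" "x \<notin> set xs"
  obtains s b where "xs = s @ b" "\<forall>y\<in>set s. y < x" "\<forall>y\<in>set b. x < y"
proof
  let ?s = "takeWhile (\<lambda>y. y < x) xs" and ?b = "dropWhile (\<lambda>y. y < x) xs"
  show "xs = ?s @ ?b" by simp
  show "\<forall>y\<in>set ?s. y < x" by (auto dest: set_takeWhileD)
  show "\<forall>y\<in>set ?b. x < y"
  proof (cases ?b)
    case (Cons p b)
    have "p \<in> set xs"
      using Cons by (metis list.set_intros(1) set_dropWhileD)
    then have "x < p"
      using hd_dropWhile[of "\<lambda>y. y < x" xs] Cons assms(2) by (auto simp: not_less le_less)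
    moreover have "x < q" if "q \<in> set b" for q
    proof -
      have "subseq [p, q] (?s @ p # b)"
        using that by (simp only: subseq_pair_append) (simp add: subseq_singleton_left)
      then have "subseq [p, q] xs"
        by (metis Cons takeWhile_dropWhile_id)
      then have "\<not> q < x" using assms(1) \<open>x < p\<close> by auto
      moreover have "q \<in> set xs"
        using that Cons by (metis list.set_intros(2) set_dropWhileD)
      ultimately show ?thesis using assms(2) by (metis linorder_neqE_nat)
    qed
    ultimately show ?thesis using Cons by auto
  next
    case Nil
    then show ?thesis by (metis empty_iff empty_set)
  qed
qed

text \<open>These are the possible lengths of the block of letters below the first letter. If the
  first letter opens a triple, the next letter must be larger, so the block is empty.\<close>

definition split_points :: "nat \<Rightarrow> nat \<Rightarrow> nat set" where
  "split_points k m = (if 3 dvd k then {0} else {..m})"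

lemma phased_words_Suc:
  "phased_words k (Suc m) c =
     (\<Union>j\<in>split_points k m. (\<lambda>(s, b). (c + j) # s @ b) `
        (phased_words (Suc k) j c \<times> phased_words (Suc k + j) (m - j) (Suc (c + j))))"
  (is "?L = ?R")
proof
  show "?L \<subseteq> ?R"
  proof
    fix w assume w: "w \<in> ?L"
    then obtain x xs where w_eq: "w = x # xs"
      using length_phased_words[OF w] by (cases w) auto
    have x: "x \<notin> set xs" and dist: "distinct xs" and av: "avoids231 (x # xs)"
      and ph: "phased k (x # xs)" and set: "insert x (set xs) = {c..<c + Suc m}"
      using w by (auto simp: phased_words_def w_eq)
    obtain s b where xs: "xs = s @ b" and s: "\<forall>y\<in>set s. y < x" and b: "\<forall>y\<in>set b. x < y"
      using avoids231_Cons_split[OF av x] by blast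
    \<comment> \<open>The block \<open>s\<close> consists of all letters below \<open>x\<close>, so
      its length is the rank of \<open>x\<close> in the interval.\<close>
    define j where "j = x - c"
    have "x \<in> {c..<c + Suc m}" using set by blast
    then have j: "x = c + j" "j \<le> m" by (auto simp: j_def)
    have "set s = {y \<in> insert x (set xs). y < x}" using xs s b by auto
    also have "\<dots> = {c..<c + j}" unfolding set using j by auto
    finally have set_s: "set s = {c..<c + j}" .
    have "set b = {y \<in> insert x (set xs). x < y}" using xs s b by auto
    also have "\<dots> = {Suc (c + j)..<Suc (c + j) + (m - j)}" unfolding set using j by auto
    finally have set_b: "set b = {Suc (c + j)..<Suc (c + j) + (m - j)}" .
    have less: "\<forall>x\<in>set s. \<forall>y\<in>set b. x < y" using s b by force
    have "length s = j" using distinct_card[of s] dist by (simp add: xs set_s)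
    then have "s \<in> phased_words (Suc k) j c"
      "b \<in> phased_words (Suc k + j) (m - j) (Suc (c + j))"
      using dist av ph set_s set_b
      by (auto simp: phased_words_def xs avoids231_append[OF less] phased_append[OF less])
    moreover have "j \<in> split_points k m"
    proof (cases "3 dvd k")
      case True
      then have "s = []"
        using ph s by (cases s) (auto simp: xs numeral_eq_Suc)
      then show ?thesis using \<open>length s = j\<close> True by (simp add: split_points_def)
    qed (use j in \<open>simp add: split_points_def\<close>)
    ultimately show "w \<in> ?R" using j(1) by (force simp: w_eq xs)
  qed
next
  show "?R \<subseteq> ?L"
  proof safe
    fix j s b
    assume j: "j \<in> split_points k m" and s: "s \<in> phased_words (Suc k) j c"
      and b: "b \<in> phased_words (Suc k + j) (m - j) (Suc (c + j))"
    have jm: "j \<le> m" using j by (auto simp: split_points_def split: if_splits)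
    have set_s: "set s = {c..<c + j}" and set_b: "set b = {Suc (c + j)..<Suc (c + m)}"
      using s b jm by (auto simp: phased_words_def)
    have less: "\<forall>x\<in>set s. \<forall>y\<in>set b. x < y" by (auto simp: set_s set_b)
    have "avoids231 ((c + j) # s @ b)"
      using s b by (auto simp: phased_words_def avoids231_append[OF less] subseq_pair_append
        dest!: subseq_pairD)
    moreover have "phased k ((c + j) # s @ b)"
      using s b j length_phased_words[OF s]
      by (auto simp: phased_words_def phased_append[OF less] split_points_def set_b
        dest!: in_set_takeD split: if_splits)
    moreover have "set ((c + j) # s @ b) = {c..<c + Suc m}"
      using jm by (auto simp: set_s set_b)
    moreover have "distinct ((c + j) # s @ b)"
      using s b by (auto simp: phased_words_def set_s set_b)
    ultimately show "(c + j) # s @ b \<in> ?L" by (simp add: phased_words_def)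
  qed
qed

section \<open>Recurrence for the number of words\<close>

lemma card_phased_words_Suc_offset:
  "card (phased_words k (Suc m) c) =
     (\<Sum>j\<in>split_points k m. card (phased_words (Suc k) j c) *
        card (phased_words (Suc k + j) (m - j) (Suc (c + j))))"
proof -
  let ?B = "\<lambda>j. phased_words (Suc k) j c \<times> phased_words (Suc k + j) (m - j) (Suc (c + j))"
  \<comment> \<open>All \<open>s\<close> have length \<open>j\<close>, so the word shows where to
    cut; different \<open>j\<close> give different first letters, hence disjoint images.\<close>
  have "inj_on (\<lambda>(s, b). (c + j) # s @ b) (?B j)" for j
    by (rule inj_onI, clarsimp) (metis length_phased_words append_eq_append_conv)
  then have "card ((\<lambda>(s, b). (c + j) # s @ b) ` ?B j) = card (?B j)" for j
    by (rule card_image)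
  moreover have "finite (split_points k m)" by (simp add: split_points_def)
  moreover have "\<forall>i\<in>split_points k m. \<forall>j\<in>split_points k m. i \<noteq> j \<longrightarrow>
      (\<lambda>(s, b). (c + i) # s @ b) ` ?B i \<inter> (\<lambda>(s, b). (c + j) # s @ b) ` ?B j = {}"
    by fastforce
  moreover have "\<forall>j\<in>split_points k m. finite ((\<lambda>(s, b). (c + j) # s @ b) ` ?B j)"
    by (intro ballI finite_imageI finite_cartesian_product finite_phased_words)
  ultimately show ?thesis
    unfolding phased_words_Suc by (simp add: card_UN_disjoint card_cartesian_product)
qed

text \<open>In the recurrence the offset enters only through the offsets of shorter words, so strong
  induction removes it without an explicit relabelling.\<close>

lemma card_phased_words_offset: "card (phased_words k m c) = card (phased_words k m 0)"
proof (induction m arbitrary: k c rule: less_induct)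
  case (less m)
  show ?case
  proof (cases m)
    case (Suc m')
    have "card (phased_words (Suc k) j c) * card (phased_words (Suc k + j) (m' - j) (Suc (c + j)))
      = card (phased_words (Suc k) j 0) * card (phased_words (Suc k + j) (m' - j) (Suc (0 + j)))"
      if "j \<in> split_points k m'" for j
    proof -
      have "j < m" using that Suc by (auto simp: split_points_def split: if_splits)
      moreover have "m' - j < m" using Suc by simp
      ultimately show ?thesis by (metis less)
    qed
    then show ?thesis
      unfolding Suc card_phased_words_Suc_offset by (rule sum.cong[OF refl])
  qed (simp add: phased_words_0)
qed

lemma card_phased_words_Suc:
  "card (phased_words k (Suc m) 0) =
     (\<Sum>j\<in>split_points k m. card (phased_words (Suc k) j 0) *
        card (phased_words (Suc k + j) (m - j) 0))"
  unfolding card_phased_words_Suc_offset card_phased_words_offset[of _ _ "Suc _"] ..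

lemma S2_231: "S2 n {[2, 3, 1]} = phased_words 0 (3 * n) 1"
proof -
  have "length xs = 3 * n" if "distinct xs" "set xs = {1..3 * n}" for xs
    using distinct_card[OF that(1)] that(2) by simp
  then show ?thesis
    by (auto simp: S2_def phased_words_def permutations_of_set_def avoids231_iff phased_0_iff
      atLeastLessThanSuc_atLeastAtMost)
qed

subsection \<open>Lagrange inversion and Catalan series\<close>

text \<open>The power \<open>\<psi> ^ k\<close> has no terms below degree \<open>k\<close>, so the
  composition may be cut off at \<open>n\<close> for all the coefficients that enter.\<close>

lemma fps_compose_mult_nth:
  fixes f g \<psi> :: "'a::comm_ring_1 fps"
  assumes "\<psi> $ 0 = 0"
  shows "((f oo \<psi>) * g) $ n = (\<Sum>k\<le>n. f $ k * (\<psi> ^ k * g) $ n)"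
proof -
  have "(f oo \<psi>) $ i = (\<Sum>k\<le>n. f $ k * (\<psi> ^ k) $ i)" if "i \<le> n" for i
    unfolding fps_compose_nth
    by (rule sum.mono_neutral_left)
      (use that startsby_zero_power_prefix[OF assms] in \<open>auto simp: not_le\<close>)
  then have "((f oo \<psi>) * g) $ n = (\<Sum>i=0..n. \<Sum>k\<le>n. f $ k * (\<psi> ^ k) $ i * g $ (n - i))"
    by (simp add: fps_mult_nth sum_distrib_right)
  also have "\<dots> = (\<Sum>k\<le>n. \<Sum>i=0..n. f $ k * (\<psi> ^ k) $ i * g $ (n - i))"
    by (rule sum.swap)
  finally show ?thesis by (simp add: fps_mult_nth sum_distrib_left mult.assoc)
qed

text \<open>This is the residue of \<open>\<psi>' / \<psi> ^ (l + 1)\<close> for \<open>\<psi> = X / \<phi>\<close>.\<close>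
lemma lagrange_residue:
  fixes \<phi> :: "'a::field_char_0 fps"
  assumes "\<phi> $ 0 \<noteq> 0"
  shows "(fps_deriv (fps_X * inverse \<phi>) * \<phi> ^ Suc l) $ l = (if l = 0 then 1 else 0)"
proof -
  have inv: "inverse \<phi> * \<phi> = 1" using assms by (rule inverse_mult_eq_1)
  have deriv: "fps_deriv (fps_X * inverse \<phi>) = inverse \<phi> - fps_X * fps_deriv \<phi> * (inverse \<phi>)\<^sup>2"
    by (simp add: fps_inverse_deriv[OF assms])
  have *: "fps_deriv (fps_X * inverse \<phi>) * \<phi> ^ Suc l
      = (inverse \<phi> * \<phi>) * \<phi> ^ l - fps_X * fps_deriv \<phi> * inverse \<phi> * (inverse \<phi> * \<phi>) * \<phi> ^ l"
    unfolding deriv by (simp add: algebra_simps power2_eq_square)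
  show ?thesis
  proof (cases l)
    case 0
    then show ?thesis using * by (simp add: inv)
  next
    case (Suc j)
    have "fps_deriv (fps_X * inverse \<phi>) * \<phi> ^ Suc l
        = \<phi> ^ l - fps_X * fps_deriv \<phi> * (inverse \<phi> * \<phi>) * \<phi> ^ j"
      unfolding * using inv by (simp add: Suc mult_ac)
    also have "\<dots> = \<phi> ^ l - fps_X * (fps_deriv \<phi> * \<phi> ^ j)"
      unfolding inv by (simp add: mult.assoc)
    finally have eq: "fps_deriv (fps_X * inverse \<phi>) * \<phi> ^ Suc l
        = \<phi> ^ l - fps_X * (fps_deriv \<phi> * \<phi> ^ j)" .
    have "fps_deriv (\<phi> ^ l) = of_nat l * (fps_deriv \<phi> * \<phi> ^ j)"
      by (simp add: fps_deriv_power Suc mult.assoc fps_of_nat del: of_nat_Suc power_Suc)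
    \<comment> \<open>The operator X d/dX multiplies the coefficient of degree l by l, so the
      right-hand side has coefficient 0 in that degree.\<close>
    then have "of_nat l * (fps_deriv (fps_X * inverse \<phi>) * \<phi> ^ Suc l)
        = of_nat l * \<phi> ^ l - fps_X * fps_deriv (\<phi> ^ l)"
      unfolding eq by (simp add: right_diff_distrib mult_ac)
    then have "(of_nat l * (fps_deriv (fps_X * inverse \<phi>) * \<phi> ^ Suc l)) $ l
        = (of_nat l * \<phi> ^ l - fps_X * fps_deriv (\<phi> ^ l)) $ l" by (rule arg_cong)
    then have "of_nat l * (fps_deriv (fps_X * inverse \<phi>) * \<phi> ^ Suc l) $ l = 0"
      by (simp add: Suc fps_of_nat[symmetric] del: of_nat_Suc power_Suc)
    then show ?thesis using Suc by (simp del: of_nat_Suc)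
  qed
qed

text \<open>Let \<psi> = X/\<phi>, let u be its compositional inverse and h = H(u), so that H =
  h(\<psi>). Differentiating and multiplying by \<open>\<phi> ^ n\<close> expands the right-hand
  series into terms \<open>\<psi> ^ k * fps_deriv \<psi> * \<phi> ^ n\<close>. Cancelling \<phi> in
  \<open>\<psi> ^ k\<close> leaves \<open>lagrange_residue\<close> shifted by k, which kills all
  terms but k = n - 1.\<close>

lemma lagrange_inversion:
  fixes \<phi> H :: "'a::field_char_0 fps"
  assumes \<phi>0: "\<phi> $ 0 \<noteq> 0" and n: "n > 0"
  shows "of_nat n * (H oo fps_inv (fps_X * inverse \<phi>)) $ n = (fps_deriv H * \<phi> ^ n) $ (n - 1)"
proof -
  define \<psi> where "\<psi> = fps_X * inverse \<phi>"
  define h where "h = H oo fps_inv \<psi>"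
  obtain m where m: "n = Suc m" using n gr0_implies_Suc by blast
  have \<psi>: "\<psi> $ 0 = 0" "\<psi> $ 1 \<noteq> 0" using \<phi>0 by (simp_all add: \<psi>_def)
  have u0: "fps_inv \<psi> $ 0 = 0" by (simp add: fps_inv_def)
  have "H = h oo \<psi>"
    unfolding h_def fps_compose_assoc[OF \<psi>(1) u0, symmetric] by (simp add: fps_inv[OF \<psi>])
  then have "fps_deriv H * \<phi> ^ n = (fps_deriv h oo \<psi>) * (fps_deriv \<psi> * \<phi> ^ n)"
    by (simp add: fps_compose_deriv[OF \<psi>(1)] mult.assoc)
  then have "(fps_deriv H * \<phi> ^ n) $ m
      = (\<Sum>k\<le>m. fps_deriv h $ k * (\<psi> ^ k * (fps_deriv \<psi> * \<phi> ^ n)) $ m)"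
    by (simp only: fps_compose_mult_nth[OF \<psi>(1)])
  also have "\<dots> = (\<Sum>k\<le>m. if k = m then fps_deriv h $ k else 0)"
  proof (rule sum.cong[OF refl])
    fix k assume k: "k \<in> {..m}"
    have "\<phi> ^ n = \<phi> ^ k * \<phi> ^ Suc (m - k)"
      using k by (simp add: m Suc_diff_le flip: power_add)
    then have "\<psi> ^ k * (fps_deriv \<psi> * \<phi> ^ n)
        = fps_X ^ k * (inverse \<phi> * \<phi>) ^ k * (fps_deriv \<psi> * \<phi> ^ Suc (m - k))"
      unfolding power_mult_distrib by (simp add: \<psi>_def power_mult_distrib mult_ac)
    also have "\<dots> = fps_X ^ k * (fps_deriv \<psi> * \<phi> ^ Suc (m - k))"
      by (simp add: inverse_mult_eq_1[OF \<phi>0])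
    finally have "(\<psi> ^ k * (fps_deriv \<psi> * \<phi> ^ n)) $ m = (fps_deriv \<psi> * \<phi> ^ Suc (m - k)) $ (m - k)"
      using k by (simp only: fps_X_power_mult_nth) simp
    then show "fps_deriv h $ k * (\<psi> ^ k * (fps_deriv \<psi> * \<phi> ^ n)) $ m
        = (if k = m then fps_deriv h $ k else 0)"
      using k lagrange_residue[OF \<phi>0, of "m - k"] by (auto simp: \<psi>_def simp del: power_Suc)
  qed
  also have "\<dots> = of_nat n * h $ n" by (simp add: m)
  finally show ?thesis by (simp add: m h_def \<psi>_def)
qed

text \<open>Composing X/\<phi> with its inverse u gives X = u/\<phi>(u). This is how series given by
  a functional equation are constructed below.\<close>

lemma fps_inv_lagrange:
  fixes \<phi> :: "'a::field_char_0 fps"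
  assumes "\<phi> $ 0 \<noteq> 0"
  defines "u \<equiv> fps_inv (fps_X * inverse \<phi>)"
  shows "u = fps_X * (\<phi> oo u)" and "u $ 0 = 0"
proof -
  show u0: "u $ 0 = 0" by (simp add: u_def fps_inv_def)
  have "fps_X = fps_X * inverse \<phi> oo u"
    unfolding u_def using assms(1) by (simp add: fps_inv_right)
  also have "\<dots> = u * inverse (\<phi> oo u)"
    by (simp add: fps_compose_mult_distrib[OF u0] fps_inverse_compose[OF u0 assms(1)] u0)
  finally have "fps_X * (\<phi> oo u) = u * (inverse (\<phi> oo u) * (\<phi> oo u))"
    by (simp add: mult.assoc)
  then show "u = fps_X * (\<phi> oo u)" using assms(1) by (simp add: inverse_mult_eq_1)
qed

lemma fps_compose_X_power_nth:
  fixes f :: "'a::comm_ring_1 fps"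
  assumes "d > 0"
  shows "(f oo fps_X ^ d) $ (d * n) = f $ n"
proof -
  have "(f oo fps_X ^ d) $ (d * n) = (\<Sum>i=0..d * n. if i = n then f $ i else 0)"
    unfolding fps_compose_nth
    using assms by (intro sum.cong) (simp_all flip: power_mult)
  then show ?thesis using assms by simp
qed

section \<open>The Catalan series and its powers\<close>

definition catalan_fps :: "real fps" where
  "catalan_fps = 1 + fps_inv (fps_X * inverse ((1 + fps_X)\<^sup>2))"

lemma catalan_fps_0: "catalan_fps $ 0 = 1"
  by (simp add: catalan_fps_def fps_inv_def)

text \<open>With \<phi> = (1 + X)^2 the series u = C - 1 solves u = X (1 + u)^2, which is the
  Catalan equation.\<close>

lemma catalan_fps_eq: "catalan_fps = 1 + fps_X * catalan_fps\<^sup>2"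
proof -
  define \<phi> :: "real fps" where "\<phi> = (1 + fps_X)\<^sup>2"
  define u where "u = fps_inv (fps_X * inverse \<phi>)"
  have \<phi>0: "\<phi> $ 0 \<noteq> 0" by (simp add: \<phi>_def)
  note u = fps_inv_lagrange[OF \<phi>0, folded u_def]
  have "\<phi> oo u = (1 + u)\<^sup>2"
    by (simp add: \<phi>_def fps_compose_power[OF u(2), symmetric] fps_compose_add_distrib u(2))
  then show ?thesis
    using u(1) by (simp add: catalan_fps_def u_def \<phi>_def)
qed

lemma one_plus_X_power_nth: "((1 + fps_X) ^ n) $ k = real (n choose k)"
proof (induction n arbitrary: k)
  case (Suc n)
  then show ?case by (cases k) (simp_all add: distrib_right)
qed (simp_all add: fps_one_def)

text \<open>These are the ballot numbers. Lagrange inversion with H = (1 + X)^r yields i [X^i] C^r =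
  r binom(2i + r - 1, i - 1) for positive i.\<close>

lemma catalan_fps_power_nth:
  assumes "r > 0"
  shows "(catalan_fps ^ r) $ i * real (r + i) = r * real ((2 * i + r - 1) choose i)"
proof (cases i)
  case 0
  then show ?thesis by (simp add: fps_power_zeroth catalan_fps_0)
next
  case (Suc j)
  define \<phi> :: "real fps" where "\<phi> = (1 + fps_X)\<^sup>2"
  define u where "u = fps_inv (fps_X * inverse \<phi>)"
  have \<phi>0: "\<phi> $ 0 \<noteq> 0" by (simp add: \<phi>_def)
  have u0: "u $ 0 = 0" by (simp add: u_def fps_inv_def)
  obtain q where q: "r = Suc q" using assms gr0_implies_Suc by blast
  have "catalan_fps ^ r = (1 + fps_X) ^ r oo u"
    by (simp add: catalan_fps_def u_def \<phi>_def fps_compose_power[symmetric]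
        fps_compose_add_distrib u0[unfolded u_def \<phi>_def])
  then have "real i * (catalan_fps ^ r) $ i = (fps_deriv ((1 + fps_X) ^ r) * \<phi> ^ i) $ j"
    using lagrange_inversion[OF \<phi>0, of i "(1 + fps_X) ^ r"] by (simp add: Suc u_def)
  also have "fps_deriv ((1 + fps_X :: real fps) ^ r) = fps_const (real r) * (1 + fps_X) ^ q"
    by (simp add: fps_deriv_power q del: power_Suc of_nat_Suc)
  also have "\<dots> * \<phi> ^ i = fps_const (real r) * (1 + fps_X) ^ (q + 2 * i)"
    by (simp add: \<phi>_def power_add power_mult mult.assoc)
  also have "\<dots> $ j = r * real ((q + 2 * i) choose j)"
    by (simp add: one_plus_X_power_nth)
  finally have c: "real i * (catalan_fps ^ r) $ i = r * real ((q + 2 * i) choose j)" .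
  \<comment> \<open>Two absorption identities trade the lower index i - 1 for i, which brings in the
    factor r + i.\<close>
  have "((q + 2 * i) choose i) * i = ((q + 2 * i) choose j) * (q + 2 * i - j)"
    using binomial_absorb_comp[of "q + 2 * i" j] binomial_absorption[of j "q + 2 * i"]
    unfolding Suc[symmetric] by (simp only: mult.commute)
  also have "q + 2 * i - j = r + i" by (simp add: q Suc)
  finally have "real ((q + 2 * i) choose i) * i = real ((q + 2 * i) choose j) * (r + i)"
    by (metis of_nat_mult)
  then have B: "real ((q + 2 * i) choose j) * real (r + i) = real ((q + 2 * i) choose i) * i" ..
  have "real i * ((catalan_fps ^ r) $ i * real (r + i))
      = real r * (real ((q + 2 * i) choose j) * real (r + i))"
    using c by (simp only: mult.assoc[symmetric])
  then have "real i * ((catalan_fps ^ r) $ i * real (r + i)) = real i * (r * real ((q + 2 * i) choose i))"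
    unfolding B by (simp only: mult_ac)
  moreover have "2 * i + r - 1 = q + 2 * i" by (simp add: q)
  moreover have "real i \<noteq> 0" using Suc by simp
  ultimately show ?thesis by simp
qed

subsection \<open>Generating functions by phase\<close>

text \<open>
  Only words that start at a position congruent to \<open>k\<close> modulo 3 and stop right before a position
  congruent to \<open>e\<close> are counted, so that a concatenation of words becomes a matrix product.
\<close>
definition phase_fps :: "nat \<Rightarrow> nat \<Rightarrow> real fps" where
  "phase_fps k e = Abs_fps (\<lambda>m. if (k + m) mod 3 = e then real (card (phased_words k m 0)) else 0)"

text \<open>After the first letter in phase \<open>k\<close>, the block of small letters starts in
  phase \<open>k + 1\<close> and stops in phase \<open>d\<close>, where the block of large letters
  starts. In phase 0 the first block is empty, so a single factor remains. The
  \<open>of_bool\<close> terms count the empty word.\<close>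

definition phase_system :: "(nat \<Rightarrow> nat \<Rightarrow> real fps) \<Rightarrow> bool" where
  "phase_system F \<longleftrightarrow> (\<forall>e<3.
     F 0 e = of_bool (e = 0) + fps_X * F 1 e \<and>
     F 1 e = of_bool (e = 1) + fps_X * (\<Sum>d<3. F 2 d * F d e) \<and>
     F 2 e = of_bool (e = 2) + fps_X * (\<Sum>d<3. F 0 d * F d e))"

lemma phase_fps_mod_3: "phase_fps (k mod 3) e = phase_fps k e"
  unfolding phase_fps_def phased_words_mod_3 by (simp add: mod_add_left_eq)

lemma phase_fps_3: "phase_fps 3 e = phase_fps 0 e"
  using phase_fps_mod_3[of 3 e] by simp

lemma phase_fps_nonzero_phase:
  assumes "\<not> 3 dvd k"
  shows "phase_fps k e
    = of_bool (k mod 3 = e) + fps_X * (\<Sum>d<3. phase_fps (Suc k) d * phase_fps d e)"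
    (is "_ = ?R")
proof (rule fps_ext)
  fix m
  let ?c = "\<lambda>k m. real (card (phased_words k m 0))"
  show "phase_fps k e $ m = ?R $ m"
  proof (cases m)
    case 0
    then show ?thesis by (simp add: phase_fps_def phased_words_0)
  next
    case (Suc m')
    have phase: "Suc k + j + (m' - j) = k + m" if "j \<in> {0..m'}" for j
      using that Suc by simp
    have summand: "(\<Sum>d<3. phase_fps (Suc k) d $ j * phase_fps d e $ (m' - j))
        = (if (k + m) mod 3 = e then ?c (Suc k) j * ?c (Suc k + j) (m' - j) else 0)"
      if "j \<in> {0..m'}" for j
    proof -
      \<comment> \<open>A block of length \<open>j\<close> stops in exactly one phase, so a single
        term of the matrix product survives.\<close>
      let ?d = "(Suc k + j) mod 3"
      have "(\<Sum>d<3. phase_fps (Suc k) d $ j * phase_fps d e $ (m' - j))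
          = (\<Sum>d<3. if d = ?d then ?c (Suc k) j * phase_fps ?d e $ (m' - j) else 0)"
        by (rule sum.cong) (simp_all add: phase_fps_def)
      also have "\<dots> = ?c (Suc k) j * phase_fps (Suc k + j) e $ (m' - j)"
        by (simp add: phase_fps_mod_3 del: add_Suc)
      also have "?c (Suc k) j * phase_fps (Suc k + j) e $ (m' - j)
        = (if (k + m) mod 3 = e then ?c (Suc k) j * ?c (Suc k + j) (m' - j) else 0)"
        by (simp only: phase_fps_def fps_nth_Abs_fps phase[OF that]) simp
      finally show ?thesis .
    qed
    have "?R $ m = (\<Sum>d<3. \<Sum>j=0..m'. phase_fps (Suc k) d $ j * phase_fps d e $ (m' - j))"
      using assms by (simp add: Suc fps_sum_nth) (simp add: fps_mult_nth)
    also have "\<dots> = (\<Sum>j=0..m'. \<Sum>d<3. phase_fps (Suc k) d $ j * phase_fps d e $ (m' - j))"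
      by (rule sum.swap)
    also have "\<dots> = (if (k + m) mod 3 = e
        then \<Sum>j=0..m'. ?c (Suc k) j * ?c (Suc k + j) (m' - j) else 0)"
      by (subst sum.cong[OF refl summand]) auto
    also have "(\<Sum>j=0..m'. ?c (Suc k) j * ?c (Suc k + j) (m' - j)) = ?c k m"
      using assms by (simp add: Suc card_phased_words_Suc split_points_def atLeast0AtMost)
    finally show ?thesis by (simp add: phase_fps_def)
  qed
qed

lemma phase_fps_zero_phase: "phase_fps 0 e = of_bool (0 = e) + fps_X * phase_fps 1 e"
proof (rule fps_ext)
  fix m
  show "phase_fps 0 e $ m = (of_bool (0 = e) + fps_X * phase_fps 1 e) $ m"
    by (cases m) (simp_all add: phase_fps_def phased_words_0 card_phased_words_Suc split_points_def)
qed

lemma phase_system_phase_fps: "phase_system phase_fps"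
  unfolding phase_system_def
proof (intro allI impI conjI)
  fix e
  show "phase_fps 0 e = of_bool (e = 0) + fps_X * phase_fps 1 e"
    using phase_fps_zero_phase[of e] by auto
  show "phase_fps 1 e = of_bool (e = 1) + fps_X * (\<Sum>d<3. phase_fps 2 d * phase_fps d e)"
    using phase_fps_nonzero_phase[of 1 e] by (auto simp: numeral_2_eq_2)
  have "\<not> 3 dvd (2 :: nat)" "Suc 2 = 3" "2 mod 3 = (2 :: nat)" by simp_all
  then show "phase_fps 2 e = of_bool (e = 2) + fps_X * (\<Sum>d<3. phase_fps 0 d * phase_fps d e)"
    using phase_fps_nonzero_phase[of 2 e] unfolding phase_fps_3 by (auto simp: phase_fps_3)
qed

text \<open>Every product in the system carries a factor X, so each coefficient is determined by
  coefficients of lower degree.\<close>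

lemma phase_system_unique:
  assumes F: "phase_system F" and G: "phase_system G" and "k < 3" "e < 3"
  shows "F k e = G k e"
proof (rule fps_ext)
  fix m
  show "F k e $ m = G k e $ m"
    using \<open>k < 3\<close> \<open>e < 3\<close>
  proof (induction m arbitrary: k e rule: less_induct)
    case (less m)
    have nth: "(fps_X * A) $ m = (fps_X * B) $ m" if "\<And>i. i < m \<Longrightarrow> A $ i = B $ i" for A B :: "real fps"
      using that by (cases m) auto
    have "(fps_X * F 1 e) $ m = (fps_X * G 1 e) $ m"
      by (rule nth) (use less in auto)
    moreover have "(fps_X * (\<Sum>d<3. F k d * F d e)) $ m = (fps_X * (\<Sum>d<3. G k d * G d e)) $ m"
      if "k < 3" for k
      by (rule nth) (auto simp: fps_sum_nth fps_mult_nth less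
        intro!: sum.cong arg_cong2[where f = "(*)"] less.IH that \<open>e < 3\<close>)
    moreover have "k \<in> {0, 1, 2}" using less.prems by auto
    ultimately show ?case
      using F G \<open>e < 3\<close> unfolding phase_system_def by auto
  qed
qed

text \<open>The parametrisation was read off from the series expansion of \<^const>\<open>phase_fps\<close>.\<close>
lemma phase_system_solution:
  fixes v c :: "real fps"
  defines "g \<equiv> (1 + v) * c"
  assumes c: "c = 1 + v * c\<^sup>2" and v: "v = fps_X ^ 3 * g ^ 5"
  shows "\<exists>F. phase_system F \<and> F 0 0 = g"
proof -
  let ?z = "fps_X :: real fps"
  \<comment> \<open>The exponent of z in entry \<open>k\<close>, \<open>e\<close> is the residue of
    \<open>e - k\<close> modulo 3, which is the length modulo 3 of a word from phase
    \<open>k\<close> to phase \<open>e\<close>.\<close>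
  define F :: "nat \<Rightarrow> nat \<Rightarrow> real fps" where "F = (\<lambda>k e.
    [[g, ?z * g\<^sup>2 * c, ?z\<^sup>2 * g ^ 4 * c],
     [?z\<^sup>2 * (1 + c) * c * g ^ 5, g\<^sup>2 * c, ?z * g ^ 4 * c],
     [?z * g ^ 3 * c, ?z\<^sup>2 * (1 + c) * g ^ 4 * c, g * c]] ! k ! e)"
  \<comment> \<open>Each product equation below reduces, on replacing z^3 g^5 by v, to an identity
    between polynomials in v, c, g. These follow from the Catalan equation and the two forms of
    g.\<close>
  have g: "g = c + v * c" by (simp add: g_def algebra_simps)
  have g2: "g = 1 + v * c * (1 + c)" using c g by algebra
  have F: "F 0 0 = g" "F 0 1 = ?z * g\<^sup>2 * c" "F 0 2 = ?z\<^sup>2 * g ^ 4 * c"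
    "F 1 0 = ?z\<^sup>2 * (1 + c) * c * g ^ 5" "F 1 1 = g\<^sup>2 * c" "F 1 2 = ?z * g ^ 4 * c"
    "F 2 0 = ?z * g ^ 3 * c" "F 2 1 = ?z\<^sup>2 * (1 + c) * g ^ 4 * c" "F 2 2 = g * c"
    by (simp_all add: F_def)
  have e00: "F 0 0 = 1 + ?z * F 1 0"
  proof -
    have "?z * F 1 0 = v * c * (1 + c)"
      unfolding F v by algebra
    then show ?thesis unfolding F using g2 by algebra
  qed
  have e10: "F 1 0 = ?z * (F 2 0 * F 0 0 + F 2 1 * F 1 0 + F 2 2 * F 2 0)"
  proof -
    have "?z * (F 2 0 * F 0 0 + F 2 1 * F 1 0 + F 2 2 * F 2 0)
        = ?z\<^sup>2 * g ^ 4 * c * (1 + v * (1 + c)\<^sup>2 * c + c)"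
      unfolding F v by algebra
    also have "1 + v * (1 + c)\<^sup>2 * c + c = (1 + c) * g" using g2 by algebra
    finally show ?thesis unfolding F by algebra
  qed
  have e20: "F 2 0 = ?z * (F 0 0 * F 0 0 + F 0 1 * F 1 0 + F 0 2 * F 2 0)"
  proof -
    have "?z * (F 0 0 * F 0 0 + F 0 1 * F 1 0 + F 0 2 * F 2 0)
        = ?z * g\<^sup>2 * (1 + v * c\<^sup>2 * (2 + c))"
      unfolding F v by algebra
    also have "1 + v * c\<^sup>2 * (2 + c) = g * c" using c g2 by algebra
    finally show ?thesis unfolding F by algebra
  qed
  have e11: "F 1 1 = 1 + ?z * (F 2 0 * F 0 1 + F 2 1 * F 1 1 + F 2 2 * F 2 1)"
  proof -
    have "?z * (F 2 0 * F 0 1 + F 2 1 * F 1 1 + F 2 2 * F 2 1)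
        = v * c\<^sup>2 * (2 + c + (1 + c) * g)"
      unfolding F v by algebra
    also have "v * c\<^sup>2 * (2 + c + (1 + c) * g) = g\<^sup>2 * c - 1" using c g2 by algebra
    finally show ?thesis unfolding F by algebra
  qed
  have e21: "F 2 1 = ?z * (F 0 0 * F 0 1 + F 0 1 * F 1 1 + F 0 2 * F 2 1)"
  proof -
    have "?z * (F 0 0 * F 0 1 + F 0 1 * F 1 1 + F 0 2 * F 2 1)
        = ?z\<^sup>2 * g ^ 3 * c * (1 + g * c + v * (1 + c) * c)"
      unfolding F v by algebra
    also have "1 + g * c + v * (1 + c) * c = (1 + c) * g" using g2 by algebra
    finally show ?thesis unfolding F by algebra
  qed
  have e12: "F 1 2 = ?z * (F 2 0 * F 0 2 + F 2 1 * F 1 2 + F 2 2 * F 2 2)"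
  proof -
    have "?z * (F 2 0 * F 0 2 + F 2 1 * F 1 2 + F 2 2 * F 2 2)
        = ?z * g\<^sup>2 * (c\<^sup>2 * (v * (1 + g * (1 + c)) + 1))"
      unfolding F v by algebra
    also have "c\<^sup>2 * (v * (1 + g * (1 + c)) + 1) = g\<^sup>2 * c" using g g2 by algebra
    finally show ?thesis unfolding F by algebra
  qed
  have e22: "F 2 2 = 1 + ?z * (F 0 0 * F 0 2 + F 0 1 * F 1 2 + F 0 2 * F 2 2)"
  proof -
    have "?z * (F 0 0 * F 0 2 + F 0 1 * F 1 2 + F 0 2 * F 2 2)
        = v * (c + c\<^sup>2 + g * c\<^sup>2)"
      unfolding F v by algebra
    also have "v * (c + c\<^sup>2 + g * c\<^sup>2) = g * c - 1" using c g by algebra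
    finally show ?thesis unfolding F by algebra
  qed
  have e01: "F 0 1 = ?z * F 1 1" "F 0 2 = ?z * F 1 2"
    unfolding F by algebra+
  have sum3: "(\<Sum>d<3. A d) = A 0 + A 1 + A 2" for A :: "nat \<Rightarrow> real fps"
    by (simp add: numeral_3_eq_3 numeral_2_eq_2)
  have "phase_system F"
    unfolding phase_system_def
  proof (intro allI impI)
    fix e :: nat assume "e < 3"
    then consider "e = 0" | "e = 1" | "e = 2" by linarith
    then show "F 0 e = of_bool (e = 0) + ?z * F 1 e \<and>
        F 1 e = of_bool (e = 1) + ?z * (\<Sum>d<3. F 2 d * F d e) \<and>
        F 2 e = of_bool (e = 2) + ?z * (\<Sum>d<3. F 0 d * F d e)"
      unfolding sum3 using e00 e10 e20 e01 e11 e21 e12 e22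
      by cases simp_all
  qed
  then show ?thesis by (auto simp: F_def)
qed

section \<open>Extraction of the coefficients\<close>

lemma lagrange_power_coeff:
  fixes H :: "real fps"
  assumes "H $ 0 \<noteq> 0"
  shows "real (d * n + 1) * (H oo fps_inv (fps_X * inverse (H ^ d))) $ n = (H ^ (d * n + 1)) $ n"
proof (cases n)
  case (Suc m)
  have "real n * (H oo fps_inv (fps_X * inverse (H ^ d))) $ n = (fps_deriv H * H ^ (d * n)) $ m"
    unfolding power_mult using lagrange_inversion[of "H ^ d" n H] assms
    by (simp add: fps_power_zeroth Suc del: power_Suc of_nat_Suc)
  \<comment> \<open>Up to the factor dn + 1 the series from Lagrange inversion is a derivative, so
    its coefficient is one of a power of H.\<close>
  moreover have "fps_deriv (H ^ (d * n + 1)) = fps_const (real (d * n + 1)) * (fps_deriv H * H ^ (d * n))"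
    by (simp only: fps_deriv_power add_diff_cancel_right' mult.assoc)
  then have "real n * (H ^ (d * n + 1)) $ n = real (d * n + 1) * (fps_deriv H * H ^ (d * n)) $ m"
    using fps_deriv_nth[of "H ^ (d * n + 1)" m] unfolding Suc
    by (simp only: fps_mult_left_const_nth Suc_eq_plus1)
  ultimately have "real n * (real (d * n + 1) * (H oo fps_inv (fps_X * inverse (H ^ d))) $ n)
      = real n * (H ^ (d * n + 1)) $ n"
    by simp
  moreover have "real n \<noteq> 0" using Suc by simp
  ultimately show ?thesis by (simp only: mult_cancel_left) simp
qed simp

lemma phase_fps_0_0_nth:
  "real (5 * n + 1) * phase_fps 0 0 $ (3 * n) = (((1 + fps_X) * catalan_fps) ^ (5 * n + 1)) $ n"
proof -
  define H where "H = (1 + fps_X) * catalan_fps"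
  have H0: "H $ 0 = 1" by (simp add: H_def catalan_fps_0)
  define u where "u = fps_inv (fps_X * inverse (H ^ 5))"
  \<comment> \<open>Here u solves u = X H(u)^5. Substituting z^3 for X gives v = z^3 H(v)^5, and
    H(v) is the series g of the solved system.\<close>
  define v where "v = u oo fps_X ^ 3"
  define c where "c = catalan_fps oo v"
  have "(H ^ 5) $ 0 \<noteq> 0" by (simp add: fps_power_zeroth H0)
  note u = fps_inv_lagrange[OF this, folded u_def]
  have v0: "v $ 0 = 0" by (simp add: v_def u(2))
  have X3: "(fps_X ^ 3 :: real fps) $ 0 = 0" by simp
  have H_v: "H oo v = (H oo u) oo fps_X ^ 3"
    unfolding v_def by (rule fps_compose_assoc[OF X3 u(2)])
  have g: "(1 + v) * c = H oo v"
    by (simp add: H_def c_def fps_compose_mult_distrib[OF v0] fps_compose_add_distrib v0)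
  have "v = (fps_X oo fps_X ^ 3) * ((H ^ 5 oo u) oo fps_X ^ 3)"
    unfolding v_def by (subst u(1)) (rule fps_compose_mult_distrib[OF X3])
  then have v: "v = fps_X ^ 3 * ((1 + v) * c) ^ 5"
    unfolding g H_v
    by (simp only: fps_compose_power[OF u(2), symmetric] fps_compose_power[OF X3, symmetric]
        fps_X_fps_compose_startby0[OF X3])
  have "c = (1 + fps_X * catalan_fps\<^sup>2) oo v"
    unfolding c_def using catalan_fps_eq by (rule arg_cong)
  also have "\<dots> = 1 + v * c\<^sup>2"
    by (simp add: c_def fps_compose_add_distrib fps_compose_mult_distrib[OF v0]
        fps_compose_power[OF v0] v0)
  finally have c: "c = 1 + v * c\<^sup>2" .
  obtain F where "phase_system F" "F 0 0 = (1 + v) * c"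
    using phase_system_solution[OF c v] by blast
  then have "phase_fps 0 0 = (1 + v) * c"
    using phase_system_unique[OF phase_system_phase_fps, of F 0 0] by simp
  then have "phase_fps 0 0 $ (3 * n) = (H oo u) $ n"
    by (simp add: g H_v fps_compose_X_power_nth)
  then show ?thesis
    using lagrange_power_coeff[of H 5 n] H0 by (simp add: u_def H_def)
qed

theorem theorem15:
  fixes n :: nat
  shows "real (card (S2 n {[2, 3, 1]})) =
    (\<Sum>i = 0..n. 1 / real (5 * n + i + 1)
        * real ((5 * n + 1) choose (n - i)) * real ((5 * n + 2 * i) choose i))"
proof -
  \<comment> \<open>This is the exponent from Lagrange inversion. Both sides are multiplied by
    \<open>r\<close>, which is cancelled at the end; the denominators r + i come from the ballot
    numbers alone.\<close>
  define r where "r = 5 * n + 1"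
  have "r > 0" by (simp add: r_def)
  have "real r * real (card (S2 n {[2, 3, 1]})) = real r * phase_fps 0 0 $ (3 * n)"
    unfolding S2_231 card_phased_words_offset[of 0 "3 * n" 1] by (simp add: phase_fps_def)
  also have "\<dots> = (catalan_fps ^ r * (1 + fps_X) ^ r) $ n"
    unfolding r_def phase_fps_0_0_nth by (simp only: power_mult_distrib mult.commute)
  \<comment> \<open>The index i is the degree taken from the Catalan power and n - i the one taken
    from (1 + X)^r.\<close>
  also have "\<dots> = (\<Sum>i=0..n. (catalan_fps ^ r) $ i * real (r choose (n - i)))"
    by (simp only: fps_mult_nth one_plus_X_power_nth)
  also have "\<dots> = (\<Sum>i=0..n. real r * (1 / real (5 * n + i + 1)
        * real ((5 * n + 1) choose (n - i)) * real ((5 * n + 2 * i) choose i)))"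
  proof (rule sum.cong[OF refl])
    fix i
    have r: "r + i = 5 * n + i + 1" "2 * i + r - 1 = 5 * n + 2 * i" by (simp_all add: r_def)
    have nonzero: "real (5 * n + i + 1) \<noteq> 0" by (simp only: of_nat_eq_0_iff)
    have "(catalan_fps ^ r) $ i = real r * real ((5 * n + 2 * i) choose i) / real (5 * n + i + 1)"
      using catalan_fps_power_nth[OF \<open>r > 0\<close>, of i]
      unfolding r by (rule iffD2[OF nonzero_eq_divide_eq[OF nonzero]])
    then show "(catalan_fps ^ r) $ i * real (r choose (n - i)) = real r * (1 / real (5 * n + i + 1)
        * real ((5 * n + 1) choose (n - i)) * real ((5 * n + 2 * i) choose i))"
      by (simp add: r_def)
  qed
  finally have "real r * real (card (S2 n {[2, 3, 1]})) = real r * (\<Sum>i=0..n. 1 / real (5 * n + i + 1)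
        * real ((5 * n + 1) choose (n - i)) * real ((5 * n + 2 * i) choose i))"
    by (simp only: sum_distrib_left)
  moreover have "real r \<noteq> 0" by (simp add: r_def)
  ultimately show ?thesis by (simp only: mult_cancel_left) simp
qed

end
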